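(* Let $V$ be a countably infinite set, let $k:V\times V\to\mathbb{C}$ (or $\mathbb{R}$) be positive definite with reproducing kernel Hilbert space $\mathscr{H}=\mathscr{H}(k)$, and assume $\delta_x\in\mathscr{H}$ for all $x\in V$. Let $(A,B)$ be the canonical symmetric pair of operators between $l^2(V)$ and $\mathscr{H}$. Then $$k_x\in \mathrm{dom}(B^*\overline{B}),\qquad \forall x\in V .$$
   Context: Inner products are conjugate linear in the first variable. Positive definite means $\sum_{(x,y)\in F\times F}k(x,y)\overline{c_x}c_y\ge 0$ for all finite $F\subset V$ and all complex $c_x$. Write $k_x:=k(\cdot,x)$; $\mathscr{H}(k)$ is the Hilbert space of functions on $V$ obtained by completing $\mathrm{span}\{k_x\}$ with $\langle k_x,k_y\rangle_{\mathscr{H}}=k(x,y)$, and $\langle k_x,f\rangle_{\mathscr{H}}=f(x)$ for $f\in\mathscr{H}$. $\delta_x$ is the function equal to $1$ at $x$ and $0$ elsewhere, viewed as an element of $l^2(V)$ or of $\mathscr{H}$. The canonical symmetric pair $(A,B)$ (defined when all $\delta_x\in\mathscr{H}$): $A:l^2(V)\to\mathscr{H}$ is the linear operator with domain $\mathrm{span}\{\delta_x:x\in V\}$ (dense in $l^2(V)$) and $A\delta_x=\delta_x\in\mathscr{H}$; $B:\mathscr{H}\to l^2(V)$ is the linear operator with domain $\mathrm{span}\{k_x:x\in V\}$ (dense in $\mathscr{H}$) and $Bk_x=\delta_x\in l^2(V)$. $\overline{B}$ is the closure of $B$, $B^*$ its Hilbert space adjoint. *)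

theory Defs
  imports "HOL-Analysis.Analysis"
begin

text \<open>
  The scalar field is a set \<open>K\<close> of complex numbers, where \<open>K\<close> is \<open>UNIV\<close> or \<open>\<real>\<close>.
  For \<open>K = \<real>\<close> all function spaces consist of real-valued functions and are
  real Hilbert spaces.
  The index set \<open>V\<close> of the kernel is the whole type \<open>'v\<close>.
\<close>

definition pd_kernel :: "('v \<Rightarrow> 'v \<Rightarrow> complex) \<Rightarrow> bool" where
  "pd_kernel k \<longleftrightarrow>
     (\<forall>F c. finite F \<longrightarrow> (\<Sum>(x, y)\<in>F \<times> F. k x y * cnj (c x) * c y) \<in> \<real>\<^sub>\<ge>\<^sub>0)"

definition kfun :: "('v \<Rightarrow> 'v \<Rightarrow> complex) \<Rightarrow> 'v \<Rightarrow> ('v \<Rightarrow> complex)" where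
  "kfun k x = (\<lambda>z. k z x)"

definition delta :: "'v \<Rightarrow> ('v \<Rightarrow> complex)" where
  "delta x = (\<lambda>z. if z = x then 1 else 0)"

definition lin_comb :: "('v \<Rightarrow> 'w \<Rightarrow> complex) \<Rightarrow> 'v set \<Rightarrow> ('v \<Rightarrow> complex) \<Rightarrow> ('w \<Rightarrow> complex)" where
  "lin_comb u F c = (\<lambda>z. \<Sum>x\<in>F. c x * u x z)"

definition lin_span :: "complex set \<Rightarrow> ('v \<Rightarrow> 'w \<Rightarrow> complex) \<Rightarrow> ('w \<Rightarrow> complex) set" where
  "lin_span K u = {lin_comb u F c |F c. finite F \<and> (\<forall>x. c x \<in> K)}"


subsection \<open>Hilbert spaces of functions and unbounded operators between them\<close>

record 'v fun_space =
  vecs :: "('v \<Rightarrow> complex) set"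
  ip :: "('v \<Rightarrow> complex) \<Rightarrow> ('v \<Rightarrow> complex) \<Rightarrow> complex"

definition hnorm :: "'v fun_space \<Rightarrow> ('v \<Rightarrow> complex) \<Rightarrow> real" where
  "hnorm S f = sqrt (Re (ip S f f))"

text \<open>
  A linear operator, defined on a subspace, is represented by its graph;
  its domain is then \<open>Domain\<close>, and the product of \<open>T\<close> after \<open>R\<close> is \<open>R O T\<close>.
\<close>

type_synonym 'v operator = "(('v \<Rightarrow> complex) \<times> ('v \<Rightarrow> complex)) set"

definition op_closure :: "'v fun_space \<Rightarrow> 'v fun_space \<Rightarrow> 'v operator \<Rightarrow> 'v operator" where
  "op_closure S S' T = {(f, g). f \<in> vecs S \<and> g \<in> vecs S' \<and>
     (\<exists>u v. (\<forall>n::nat. (u n, v n) \<in> T) \<and>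
       (\<lambda>n. hnorm S (\<lambda>z. u n z - f z)) \<longlonglongrightarrow> 0 \<and>
       (\<lambda>n. hnorm S' (\<lambda>z. v n z - g z)) \<longlonglongrightarrow> 0)}"

definition op_adjoint :: "'v fun_space \<Rightarrow> 'v fun_space \<Rightarrow> 'v operator \<Rightarrow> 'v operator" where
  "op_adjoint S S' T = {(g, h). g \<in> vecs S' \<and> h \<in> vecs S \<and>
     (\<forall>(f, Tf)\<in>T. ip S' Tf g = ip S f h)}"

text \<open>
  The graph of the linear operator with domain \<open>lin_span K u\<close> that maps each \<open>u x\<close> to \<open>v x\<close>.
\<close>

definition lin_op ::
    "complex set \<Rightarrow> ('v \<Rightarrow> 'v \<Rightarrow> complex) \<Rightarrow> ('v \<Rightarrow> 'v \<Rightarrow> complex) \<Rightarrow> 'v operator" where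
  "lin_op K u v = {(lin_comb u F c, lin_comb v F c) |F c. finite F \<and> (\<forall>x. c x \<in> K)}"


subsection \<open>The two Hilbert spaces\<close>

definition l2_space :: "complex set \<Rightarrow> 'v fun_space" where
  "l2_space K =
     \<lparr>vecs = {f. (\<forall>x. f x \<in> K) \<and> (\<lambda>x. (cmod (f x))\<^sup>2) summable_on UNIV},
      ip = (\<lambda>f g. \<Sum>\<^sub>\<infinity>x. cnj (f x) * g x)\<rparr>"

text \<open>
  The inner product on the span of the functions \<open>kfun k x\<close>, that is, the sesquilinear
  extension of \<open>\<langle>kfun k x, kfun k y\<rangle> = k x y\<close>. For positive definite \<open>k\<close> the value does not
  depend on the coefficients \<open>c\<close> and \<open>d\<close> that represent \<open>f\<close> and \<open>g\<close>.
\<close>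

definition pre_ip ::
    "('v \<Rightarrow> 'v \<Rightarrow> complex) \<Rightarrow> ('v \<Rightarrow> complex) \<Rightarrow> ('v \<Rightarrow> complex) \<Rightarrow> complex" where
  "pre_ip k f g = (THE w. \<exists>F c G d. finite F \<and> finite G \<and>
     f = lin_comb (kfun k) F c \<and> g = lin_comb (kfun k) G d \<and>
     w = (\<Sum>x\<in>F. \<Sum>y\<in>G. cnj (c x) * d y * k x y))"

definition pre_norm :: "('v \<Rightarrow> 'v \<Rightarrow> complex) \<Rightarrow> ('v \<Rightarrow> complex) \<Rightarrow> real" where
  "pre_norm k f = sqrt (Re (pre_ip k f f))"

text \<open>
  The completion is realised by functions: a Cauchy sequence in the span of the \<open>kfun k x\<close>
  converges pointwise, and it is identified with its pointwise limit. This is injective,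
  because a Cauchy sequence that tends to \<open>0\<close> pointwise tends to \<open>0\<close> in \<open>pre_norm k\<close>.
\<close>

definition represents ::
    "complex set \<Rightarrow> ('v \<Rightarrow> 'v \<Rightarrow> complex) \<Rightarrow> (nat \<Rightarrow> 'v \<Rightarrow> complex) \<Rightarrow> ('v \<Rightarrow> complex) \<Rightarrow> bool" where
  "represents K k s f \<longleftrightarrow>
     (\<forall>n. s n \<in> lin_span K (kfun k)) \<and>
     (\<forall>e>0. \<exists>N. \<forall>m\<ge>N. \<forall>n\<ge>N. pre_norm k (\<lambda>z. s m z - s n z) < e) \<and>
     (\<forall>z. (\<lambda>n. s n z) \<longlonglongrightarrow> f z)"

definition rkhs :: "complex set \<Rightarrow> ('v \<Rightarrow> 'v \<Rightarrow> complex) \<Rightarrow> 'v fun_space" where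
  "rkhs K k =
     \<lparr>vecs = {f. \<exists>s. represents K k s f},
      ip = (\<lambda>f g. THE w. \<exists>s t. represents K k s f \<and> represents K k t g \<and>
                      (\<lambda>n. pre_ip k (s n) (t n)) \<longlonglongrightarrow> w)\<rparr>"


subsection \<open>The canonical symmetric pair\<close>

text \<open>
  The first component is \<open>A : l\<^sup>2 \<rightarrow> \<H>\<close> with \<open>A \<delta>\<^sub>x = \<delta>\<^sub>x\<close>, the second is
  \<open>B : \<H> \<rightarrow> l\<^sup>2\<close> with \<open>B k\<^sub>x = \<delta>\<^sub>x\<close>. If all \<open>\<delta>\<^sub>x\<close> lie in \<open>\<H>\<close>, then the functions
  \<open>k\<^sub>x\<close> are linearly independent, and so both graphs are single-valued.
\<close>

definition canonical_pair ::
    "complex set \<Rightarrow> ('v \<Rightarrow> 'v \<Rightarrow> complex) \<Rightarrow> 'v operator \<times> 'v operator" where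
  "canonical_pair K k = (lin_op K delta delta, lin_op K (kfun k) delta)"

end

theory Submission
  imports Defs
begin

text \<open>
  On the span of the \<open>k\<^sub>x\<close> the reproducing property \<open>\<langle>\<Sum> c\<^sub>x k\<^sub>x, g\<rangle> = \<Sum> cnj c\<^sub>x g(x)\<close> holds, and it
  extends to all \<open>g\<close> in the completion: if \<open>u\<^sub>n\<close> is Cauchy and tends to \<open>0\<close> pointwise, and \<open>t\<^sub>n\<close> is
  Cauchy, then \<open>\<langle>u\<^sub>n, t\<^sub>n\<rangle> = \<langle>u\<^sub>n, t\<^sub>n - t\<^sub>N\<rangle> + \<langle>u\<^sub>n, t\<^sub>N\<rangle>\<close> is small, the first term by Cauchy--Schwarz,
  the second because \<open>t\<^sub>N\<close> is a finite combination of the \<open>k\<^sub>y\<close>. Hence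
  \<open>\<langle>k\<^sub>y, \<delta>\<^sub>x\<rangle> = \<delta>\<^sub>x(y) = \<langle>B k\<^sub>y, \<delta>\<^sub>x\<rangle>\<close>, so that \<open>\<delta>\<^sub>x = B k\<^sub>x\<close> lies in the domain of \<open>B\<^sup>*\<close>
  and \<open>B\<^sup>* B k\<^sub>x = \<delta>\<^sub>x\<close>.
\<close>

subsection \<open>Linear combinations\<close>

lemma lin_span_mono: "K \<subseteq> L \<Longrightarrow> lin_span K u \<subseteq> lin_span L u"
  unfolding lin_span_def by blast

lemma lin_span_lin_comb: "finite F \<Longrightarrow> lin_comb u F c \<in> lin_span UNIV u"
  unfolding lin_span_def by blast

lemma lin_spanE:
  assumes "f \<in> lin_span UNIV u"
  obtains F c where "finite F" "f = lin_comb u F c"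
  using assms unfolding lin_span_def by blast

text \<open>Padding the coefficients with zeros brings two combinations to a common index set, where
  they can be added.\<close>

lemma lin_comb_mono_neutral:
  assumes "finite G" "F \<subseteq> G"
  shows "lin_comb u F c = lin_comb u G (\<lambda>x. if x \<in> F then c x else 0)"
proof
  fix z
  show "lin_comb u F c z = lin_comb u G (\<lambda>x. if x \<in> F then c x else 0) z"
    unfolding lin_comb_def using assms by (intro sum.mono_neutral_cong_left) auto
qed

lemma lin_span_combine:
  assumes "f \<in> lin_span UNIV u" "g \<in> lin_span UNIV u"
  shows "(\<lambda>z. a * f z + b * g z) \<in> lin_span UNIV u"
proof -
  obtain F c where F: "finite F" "f = lin_comb u F c"
    using assms(1) by (rule lin_spanE)
  obtain G d where G: "finite G" "g = lin_comb u G d"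
    using assms(2) by (rule lin_spanE)
  let ?c = "\<lambda>x. if x \<in> F then c x else 0" and ?d = "\<lambda>x. if x \<in> G then d x else 0"
  have f: "f = lin_comb u (F \<union> G) ?c"
    unfolding F(2) using F G by (intro lin_comb_mono_neutral) auto
  have g: "g = lin_comb u (F \<union> G) ?d"
    unfolding G(2) using F G by (intro lin_comb_mono_neutral) auto
  have "(\<lambda>z. a * f z + b * g z) = lin_comb u (F \<union> G) (\<lambda>x. a * ?c x + b * ?d x)"
    unfolding f g lin_comb_def
    by (rule ext) (simp add: sum_distrib_left sum.distrib distrib_right mult.assoc)
  then show ?thesis
    using F G by (simp only: lin_span_lin_comb finite_Un)
qed

lemma lin_span_diff:
  assumes "f \<in> lin_span UNIV u" "g \<in> lin_span UNIV u"
  shows "(\<lambda>z. f z - g z) \<in> lin_span UNIV u"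
  using lin_span_combine[OF assms, of 1 "-1"] by simp

lemma lin_span_add:
  assumes "f \<in> lin_span UNIV u" "g \<in> lin_span UNIV u"
  shows "(\<lambda>z. f z + g z) \<in> lin_span UNIV u"
  using lin_span_combine[OF assms, of 1 1] by simp

lemma lin_comb_delta:
  assumes "finite F"
  shows "lin_comb delta F c x = (if x \<in> F then c x else 0)"
  using assms by (simp add: lin_comb_def delta_def if_distrib cong: if_cong)

lemma lin_comb_single: "lin_comb u {x} (\<lambda>_. 1) = u x"
  by (simp add: lin_comb_def)


subsection \<open>The inner product on the span of the kernel functions\<close>

text \<open>Positivity includes that the quadratic form is real. The coefficients (1, 1) and (1,
  \<i>) at two points give the imaginary and the real part of the symmetry.\<close>

lemma pd_kernel_hermitian:
  assumes "pd_kernel k"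
  shows "k y x = cnj (k x y)"
proof -
  have pd: "Im (\<Sum>(x, y)\<in>F \<times> F. k x y * cnj (c x) * c y) = 0" if "finite F" for F c
    using assms that unfolding pd_kernel_def complex_nonneg_Reals_iff by blast
  have diag: "Im (k x x) = 0" for x
    using pd[of "{x}" "\<lambda>_. 1"] by simp
  show ?thesis
  proof (cases "x = y")
    case True
    then show ?thesis using diag by (simp add: complex_eq_iff)
  next
    case False
    have "Im (k x y) + Im (k y x) = 0"
      using pd[of "{x, y}" "\<lambda>_. 1"] False diag
      by (simp add: sum.cartesian_product[symmetric])
    moreover have "Re (k x y) - Re (k y x) = 0"
      using pd[of "{x, y}" "\<lambda>z. if z = x then 1 else \<i>"] False diag
      by (simp add: sum.cartesian_product[symmetric])
    ultimately show ?thesis by (simp add: complex_eq_iff)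
  qed
qed

context
  fixes k :: "'v \<Rightarrow> 'v \<Rightarrow> complex"
  assumes pd: "pd_kernel k"
begin

text \<open>Complex coefficients are allowed here whatever \<open>K\<close> is, so the estimates
  below serve both scalar fields; \<open>represents_in_kspan\<close> passes from \<open>K\<close> to
  this span.\<close>

abbreviation "kspan \<equiv> lin_span UNIV (kfun k)"

section \<open>Well-definedness and sesquilinearity of the form\<close>

lemma kernel_form_left:
  "(\<Sum>x\<in>F. \<Sum>y\<in>G. cnj (c x) * d y * k x y) = (\<Sum>x\<in>F. cnj (c x) * lin_comb (kfun k) G d x)"
  by (simp add: lin_comb_def kfun_def sum_distrib_left mult.assoc)

lemma kernel_form_right:
  "(\<Sum>x\<in>F. \<Sum>y\<in>G. cnj (c x) * d y * k x y) = (\<Sum>y\<in>G. cnj (lin_comb (kfun k) F c y) * d y)"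
proof -
  have "(\<Sum>x\<in>F. \<Sum>y\<in>G. cnj (c x) * d y * k x y) = (\<Sum>y\<in>G. \<Sum>x\<in>F. cnj (c x) * d y * k x y)"
    by (rule sum.swap)
  also have "\<dots> = (\<Sum>y\<in>G. \<Sum>x\<in>F. cnj (c x) * cnj (k y x) * d y)"
    by (intro sum.cong refl) (simp add: pd_kernel_hermitian[OF pd, symmetric] mult_ac)
  finally show ?thesis
    by (simp add: lin_comb_def kfun_def sum_distrib_right)
qed

text \<open>By \<open>kernel_form_right\<close> the double sum depends on \<open>c\<close> only
  through the first function, by \<open>kernel_form_left\<close> on \<open>d\<close> only through
  the second. Hence the representations can be exchanged one at a time.\<close>

lemma pre_ip_lin_comb:
  assumes "finite F" "finite G"
  shows "pre_ip k (lin_comb (kfun k) F c) (lin_comb (kfun k) G d)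
           = (\<Sum>x\<in>F. \<Sum>y\<in>G. cnj (c x) * d y * k x y)" (is "?lhs = ?w")
  unfolding pre_ip_def
proof (rule the_equality)
  show "\<exists>F' c' G' d'. finite F' \<and> finite G' \<and>
     lin_comb (kfun k) F c = lin_comb (kfun k) F' c' \<and>
     lin_comb (kfun k) G d = lin_comb (kfun k) G' d' \<and>
     ?w = (\<Sum>x\<in>F'. \<Sum>y\<in>G'. cnj (c' x) * d' y * k x y)"
    using assms by blast
next
  fix w
  assume "\<exists>F' c' G' d'. finite F' \<and> finite G' \<and>
     lin_comb (kfun k) F c = lin_comb (kfun k) F' c' \<and>
     lin_comb (kfun k) G d = lin_comb (kfun k) G' d' \<and>
     w = (\<Sum>x\<in>F'. \<Sum>y\<in>G'. cnj (c' x) * d' y * k x y)"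
  then obtain F' c' G' d' where
    f: "lin_comb (kfun k) F c = lin_comb (kfun k) F' c'" and
    g: "lin_comb (kfun k) G d = lin_comb (kfun k) G' d'" and
    w: "w = (\<Sum>x\<in>F'. \<Sum>y\<in>G'. cnj (c' x) * d' y * k x y)"
    by blast
  have "w = (\<Sum>x\<in>F. \<Sum>y\<in>G'. cnj (c x) * d' y * k x y)"
    unfolding w kernel_form_right f ..
  also have "\<dots> = ?w"
    unfolding kernel_form_left g ..
  finally show "w = ?w" .
qed

lemma pre_ip_reproducing:
  assumes "finite F" "g \<in> kspan"
  shows "pre_ip k (lin_comb (kfun k) F c) g = (\<Sum>x\<in>F. cnj (c x) * g x)"
  using assms(2) by (rule lin_spanE) (simp add: pre_ip_lin_comb assms(1) kernel_form_left)

lemma pre_ip_cnj: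
  assumes "f \<in> kspan" "g \<in> kspan"
  shows "pre_ip k g f = cnj (pre_ip k f g)"
proof -
  obtain F c where F: "finite F" "f = lin_comb (kfun k) F c"
    using assms(1) by (rule lin_spanE)
  obtain G d where G: "finite G" "g = lin_comb (kfun k) G d"
    using assms(2) by (rule lin_spanE)
  have "pre_ip k f g = (\<Sum>y\<in>G. cnj (f y) * d y)"
    unfolding F(2) G(2) by (simp add: pre_ip_lin_comb F G kernel_form_right)
  moreover have "pre_ip k g f = (\<Sum>y\<in>G. cnj (d y) * f y)"
    unfolding G(2) using G assms by (simp add: pre_ip_reproducing)
  ultimately show ?thesis
    by (simp add: mult.commute)
qed

lemma pre_ip_combine_right:
  assumes "f \<in> kspan" "g \<in> kspan" "h \<in> kspan"
  shows "pre_ip k f (\<lambda>z. a * g z + b * h z) = a * pre_ip k f g + b * pre_ip k f h"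
proof -
  obtain F c where F: "finite F" "f = lin_comb (kfun k) F c"
    using assms(1) by (rule lin_spanE)
  show ?thesis
    unfolding F(2)
    using lin_span_combine[OF assms(2,3), of a b] assms F(1)
    by (simp add: pre_ip_reproducing sum_distrib_left sum.distrib algebra_simps)
qed

lemma pre_ip_combine_left:
  assumes "f \<in> kspan" "g \<in> kspan" "h \<in> kspan"
  shows "pre_ip k (\<lambda>z. a * g z + b * h z) f = cnj a * pre_ip k g f + cnj b * pre_ip k h f"
proof -
  have "pre_ip k (\<lambda>z. a * g z + b * h z) f = cnj (pre_ip k f (\<lambda>z. a * g z + b * h z))"
    by (intro pre_ip_cnj assms lin_span_combine)
  also have "\<dots> = cnj a * cnj (pre_ip k f g) + cnj b * cnj (pre_ip k f h)"
    by (simp add: pre_ip_combine_right assms)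
  also have "\<dots> = cnj a * pre_ip k g f + cnj b * pre_ip k h f"
    by (simp add: pre_ip_cnj[OF assms(1)] assms)
  finally show ?thesis .
qed

section \<open>Positivity and the Cauchy-Schwarz inequality\<close>

lemma pre_ip_self_nonneg:
  assumes "f \<in> kspan"
  shows "Re (pre_ip k f f) \<ge> 0"
proof -
  obtain F c where F: "finite F" "f = lin_comb (kfun k) F c"
    using assms by (rule lin_spanE)
  have "(\<Sum>(x, y)\<in>F \<times> F. k x y * cnj (c x) * c y) \<in> \<real>\<^sub>\<ge>\<^sub>0"
    using pd F(1) unfolding pd_kernel_def by blast
  moreover have "pre_ip k f f = (\<Sum>(x, y)\<in>F \<times> F. k x y * cnj (c x) * c y)"
    unfolding F(2) by (simp add: pre_ip_lin_comb F sum.cartesian_product mult_ac)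
  ultimately show ?thesis
    by (simp add: complex_nonneg_Reals_iff)
qed

lemma pre_norm_square:
  assumes "f \<in> kspan"
  shows "(pre_norm k f)\<^sup>2 = Re (pre_ip k f f)"
  by (simp add: pre_norm_def pre_ip_self_nonneg assms)

lemma pre_norm_nonneg:
  assumes "f \<in> kspan"
  shows "pre_norm k f \<ge> 0"
  by (simp add: pre_norm_def pre_ip_self_nonneg assms)

lemma pre_ip_self_combine:
  assumes "f \<in> kspan" "g \<in> kspan"
  shows "Re (pre_ip k (\<lambda>z. a * f z + b * g z) (\<lambda>z. a * f z + b * g z))
    = (cmod a)\<^sup>2 * Re (pre_ip k f f) + (cmod b)\<^sup>2 * Re (pre_ip k g g)
      + 2 * Re (cnj a * b * pre_ip k f g)"
proof -
  have real: "Im (pre_ip k h h) = 0" if "h \<in> kspan" for h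
    using arg_cong[OF pre_ip_cnj[OF that that], of Im] by simp
  have "pre_ip k (\<lambda>z. a * f z + b * g z) (\<lambda>z. a * f z + b * g z)
    = cnj a * (a * pre_ip k f f + b * pre_ip k f g)
      + cnj b * (a * cnj (pre_ip k f g) + b * pre_ip k g g)"
    by (simp add: pre_ip_combine_left pre_ip_combine_right lin_span_combine assms
        pre_ip_cnj[OF assms])
  then show ?thesis
    using real[OF assms(1)] real[OF assms(2)]
    by (simp add: cmod_power2) (simp add: power2_eq_square algebra_simps)
qed

lemma pre_norm_Cauchy_Schwarz:
  assumes "f \<in> kspan" "g \<in> kspan"
  shows "cmod (pre_ip k f g) \<le> pre_norm k f * pre_norm k g"
proof -
  define p q b where "p = Re (pre_ip k f f)" and "q = Re (pre_ip k g g)" and "b = pre_ip k f g"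
  \<comment> \<open>This is the square of the seminorm of g - r b f. The factor \<open>b\<close>
    makes the cross term real.\<close>
  have quad: "0 \<le> q - 2 * r * (cmod b)\<^sup>2 + r\<^sup>2 * (cmod b)\<^sup>2 * p" for r :: real
  proof -
    have "0 \<le> Re (pre_ip k (\<lambda>z. (- of_real r * b) * f z + 1 * g z)
                          (\<lambda>z. (- of_real r * b) * f z + 1 * g z))"
      by (intro pre_ip_self_nonneg lin_span_combine assms)
    also have "\<dots> = q - 2 * r * (cmod b)\<^sup>2 + r\<^sup>2 * (cmod b)\<^sup>2 * p"
      unfolding pre_ip_self_combine[OF assms] p_def[symmetric] q_def[symmetric] b_def[symmetric]
      by (simp add: norm_mult power_mult_distrib cmod_power2)
         (simp add: power2_eq_square algebra_simps)
    finally show ?thesis .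
  qed
  have "(cmod b)\<^sup>2 \<le> p * q"
  proof (cases "p = 0")
    case True
    have "(cmod b)\<^sup>2 = 0"
    proof (rule ccontr)
      assume "(cmod b)\<^sup>2 \<noteq> 0"
      then show False
        \<comment> \<open>For p = 0 the bound is affine in r, and this r gives it the value
          -1.\<close>
        using quad[of "(q + 1) / (2 * (cmod b)\<^sup>2)"] True by (simp add: field_simps)
    qed
    then show ?thesis using True by simp
  next
    case False
    then have "p > 0"
      using pre_ip_self_nonneg[OF assms(1)] by (simp add: p_def)
    then show ?thesis
      \<comment> \<open>The quadratic in r is smallest at 1 / p, where it equals q - |b|^2 /
        p.\<close>
      using quad[of "1 / p"] by (simp add: field_simps power2_eq_square)
  qed
  then have "(cmod b)\<^sup>2 \<le> (pre_norm k f * pre_norm k g)\<^sup>2"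
    by (simp add: power_mult_distrib pre_norm_square assms p_def q_def)
  then show ?thesis
    unfolding b_def by (rule power2_le_imp_le) (simp add: pre_norm_nonneg assms)
qed

text \<open>Expanding the nonnegative square of f - g bounds the cross term. This weak triangle
  inequality suffices to bound Cauchy sequences.\<close>

lemma pre_norm_square_add_le:
  assumes "f \<in> kspan" "g \<in> kspan"
  shows "(pre_norm k (\<lambda>z. f z + g z))\<^sup>2 \<le> 2 * (pre_norm k f)\<^sup>2 + 2 * (pre_norm k g)\<^sup>2"
proof -
  have "0 \<le> Re (pre_ip k (\<lambda>z. 1 * f z + (-1) * g z) (\<lambda>z. 1 * f z + (-1) * g z))"
    by (intro pre_ip_self_nonneg lin_span_combine assms)
  then have "2 * Re (pre_ip k f g) \<le> Re (pre_ip k f f) + Re (pre_ip k g g)"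
    unfolding pre_ip_self_combine[OF assms] by simp
  moreover have "(pre_norm k (\<lambda>z. f z + g z))\<^sup>2
      = Re (pre_ip k f f) + Re (pre_ip k g g) + 2 * Re (pre_ip k f g)"
    using pre_ip_self_combine[OF assms, of 1 1] by (simp add: pre_norm_square lin_span_add assms)
  ultimately show ?thesis
    by (simp add: pre_norm_square assms)
qed


subsection \<open>The reproducing property on the completion\<close>

lemma represents_in_kspan:
  assumes "represents K k s f"
  shows "s n \<in> kspan"
  using assms lin_span_mono[of K UNIV "kfun k"] unfolding represents_def by blast

lemma pre_norm_zero: "pre_norm k (\<lambda>z. 0) = 0"
  using pre_ip_lin_comb[of "{}" "{}"] by (simp add: pre_norm_def lin_comb_def)

lemma represents_const:
  assumes "f \<in> lin_span K (kfun k)"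
  shows "represents K k (\<lambda>n. f) f"
  using assms by (simp add: represents_def pre_norm_zero)

text \<open>Pairing with a fixed element of the span involves only finitely many point evaluations,
  so pointwise convergence is enough.\<close>

lemma tendsto_pre_ip_right:
  assumes "f \<in> kspan" "\<And>n. t n \<in> kspan" "\<And>z. (\<lambda>n. t n z) \<longlonglongrightarrow> 0"
  shows "(\<lambda>n. pre_ip k f (t n)) \<longlonglongrightarrow> 0"
proof -
  obtain F c where F: "finite F" "f = lin_comb (kfun k) F c"
    using assms(1) by (rule lin_spanE)
  have "(\<lambda>n. \<Sum>x\<in>F. cnj (c x) * t n x) \<longlonglongrightarrow> (\<Sum>x\<in>F. cnj (c x) * 0)"
    by (intro tendsto_intros assms(3))
  then show ?thesis
    unfolding F(2) by (simp add: pre_ip_reproducing F(1) assms(2))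
qed

text \<open>Applied to the difference of two sequences with the same pointwise limit, this shows
  that the choice of sequence does not affect the limit of the inner products.\<close>

lemma tendsto_pre_ip_zero:
  assumes u: "\<And>n. u n \<in> kspan"
    and u_Cauchy: "\<And>e. e > 0 \<Longrightarrow> \<exists>N. \<forall>m\<ge>N. \<forall>n\<ge>N. pre_norm k (\<lambda>z. u m z - u n z) < e"
    and u_lim: "\<And>z. (\<lambda>n. u n z) \<longlonglongrightarrow> 0"
    and t: "\<And>n. t n \<in> kspan"
    and t_Cauchy: "\<And>e. e > 0 \<Longrightarrow> \<exists>N. \<forall>m\<ge>N. \<forall>n\<ge>N. pre_norm k (\<lambda>z. t m z - t n z) < e"
  shows "(\<lambda>n. pre_ip k (u n) (t n)) \<longlonglongrightarrow> 0"
proof -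
  obtain N where N: "\<And>n. n \<ge> N \<Longrightarrow> pre_norm k (\<lambda>z. u n z - u N z) < 1"
    using u_Cauchy[of 1] by auto
  \<comment> \<open>The bound comes from u n = (u n - u N) + u N with a first part of norm below 1.
    The summand 2 also makes \<open>M\<close> positive, so that e / (2 * M) is a valid
    tolerance.\<close>
  define M where "M = sqrt (2 + 2 * (pre_norm k (u N))\<^sup>2)"
  have "M > 0"
    by (simp add: M_def add_pos_nonneg)
  have bound: "pre_norm k (u n) \<le> M" if "n \<ge> N" for n
  proof -
    have d: "(\<lambda>z. u n z - u N z) \<in> kspan"
      by (intro lin_span_diff u)
    have "(pre_norm k (\<lambda>z. u n z - u N z))\<^sup>2 \<le> 1"
      using N[OF that] pre_norm_nonneg[OF d] by (simp add: power_le_one)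
    then have "(pre_norm k (u n))\<^sup>2 \<le> 2 + 2 * (pre_norm k (u N))\<^sup>2"
      using pre_norm_square_add_le[OF d u[of N]] by simp
    then show ?thesis
      unfolding M_def by (rule real_le_rsqrt)
  qed
  show ?thesis
  proof (rule LIMSEQ_I)
    fix e :: real assume "e > 0"
    obtain P where P: "\<And>n. n \<ge> P \<Longrightarrow> pre_norm k (\<lambda>z. t n z - t P z) < e / (2 * M)"
      using t_Cauchy[of "e / (2 * M)"] \<open>e > 0\<close> \<open>M > 0\<close> by auto
    have "(\<lambda>n. pre_ip k (t P) (u n)) \<longlonglongrightarrow> 0"
      using t u u_lim by (rule tendsto_pre_ip_right)
    then obtain Q where Q: "\<And>n. n \<ge> Q \<Longrightarrow> cmod (pre_ip k (t P) (u n)) < e / 2"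
      using LIMSEQ_D[of _ 0 "e / 2"] \<open>e > 0\<close> by fastforce
    have "cmod (pre_ip k (u n) (t n)) < e" if n: "n \<ge> max N (max P Q)" for n
    proof -
      have d: "(\<lambda>z. t n z - t P z) \<in> kspan"
        by (intro lin_span_diff t)
      have "cmod (pre_ip k (u n) (\<lambda>z. t n z - t P z))
          \<le> pre_norm k (u n) * pre_norm k (\<lambda>z. t n z - t P z)"
        using u d by (rule pre_norm_Cauchy_Schwarz)
      also have "\<dots> \<le> M * (e / (2 * M))"
        using bound[of n] P[of n] n \<open>M > 0\<close> pre_norm_nonneg[OF d] by (intro mult_mono) auto
      also have "\<dots> = e / 2"
        using \<open>M > 0\<close> by simp
      finally have 1: "cmod (pre_ip k (u n) (\<lambda>z. t n z - t P z)) \<le> e / 2" .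
      have 2: "cmod (pre_ip k (u n) (t P)) < e / 2"
        using Q[of n] n by (simp add: pre_ip_cnj[OF t u])
      have "pre_ip k (u n) (t n) = pre_ip k (u n) (\<lambda>z. t n z - t P z) + pre_ip k (u n) (t P)"
        using pre_ip_combine_right[OF u d t, of n 1 1 P] by simp
      then show ?thesis
        using norm_triangle_ineq[of "pre_ip k (u n) (\<lambda>z. t n z - t P z)" "pre_ip k (u n) (t P)"] 1 2
        by simp
    qed
    then show "\<exists>n0. \<forall>n\<ge>n0. cmod (pre_ip k (u n) (t n) - 0) < e"
      by (metis diff_zero)
  qed
qed

text \<open>With f the given combination, split s n = (s n - f) + f: the first part contributes 0 in
  the limit, the second a finite sum of values of t n. Arbitrary sequences are treated because the
  \<open>THE\<close> in \<open>rkhs\<close> ranges over all of them.\<close>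

lemma tendsto_pre_ip_represents:
  assumes F: "finite F" and s: "represents K k s (lin_comb (kfun k) F c)"
    and t: "represents K k t g"
  shows "(\<lambda>n. pre_ip k (s n) (t n)) \<longlonglongrightarrow> (\<Sum>x\<in>F. cnj (c x) * g x)"
proof -
  define f where "f = lin_comb (kfun k) F c"
  have f: "f \<in> kspan"
    unfolding f_def using F by (rule lin_span_lin_comb)
  note s_span = represents_in_kspan[OF s] and t_span = represents_in_kspan[OF t]
  have "(\<lambda>n. pre_ip k (\<lambda>z. s n z - f z) (t n)) \<longlonglongrightarrow> 0"
  proof (rule tendsto_pre_ip_zero)
    show "(\<lambda>n. s n z - f z) \<longlonglongrightarrow> 0" for z
      using s by (simp add: represents_def f_def LIM_zero)
  qed (use s t in \<open>auto simp: represents_def intro!: lin_span_diff s_span t_span f\<close>)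
  moreover have "(\<lambda>n. pre_ip k f (t n)) \<longlonglongrightarrow> (\<Sum>x\<in>F. cnj (c x) * g x)"
    unfolding f_def pre_ip_reproducing[OF F t_span]
    using t by (intro tendsto_intros) (simp add: represents_def)
  ultimately have "(\<lambda>n. pre_ip k (\<lambda>z. s n z - f z) (t n) + pre_ip k f (t n))
      \<longlonglongrightarrow> 0 + (\<Sum>x\<in>F. cnj (c x) * g x)"
    by (rule tendsto_add)
  moreover have "pre_ip k (\<lambda>z. s n z - f z) (t n) + pre_ip k f (t n) = pre_ip k (s n) (t n)" for n
    using pre_ip_combine_left[OF t_span[of n] s_span[of n] f, of 1 "-1"] by simp
  ultimately show ?thesis
    by simp
qed

text \<open>The constant sequence and any sequence for \<open>g\<close> witness the value;
  uniqueness holds since all representing sequences give the same limit.\<close>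

lemma rkhs_reproducing:
  assumes "finite F" "\<forall>x. c x \<in> K" "g \<in> vecs (rkhs K k)"
  shows "ip (rkhs K k) (lin_comb (kfun k) F c) g = (\<Sum>x\<in>F. cnj (c x) * g x)"
proof -
  obtain t where t: "represents K k t g"
    using assms(3) by (auto simp: rkhs_def)
  have "lin_comb (kfun k) F c \<in> lin_span K (kfun k)"
    using assms unfolding lin_span_def by blast
  then have s: "represents K k (\<lambda>n. lin_comb (kfun k) F c) (lin_comb (kfun k) F c)"
    by (rule represents_const)
  have "(THE w. \<exists>s t. represents K k s (lin_comb (kfun k) F c) \<and> represents K k t g \<and>
          (\<lambda>n. pre_ip k (s n) (t n)) \<longlonglongrightarrow> w) = (\<Sum>x\<in>F. cnj (c x) * g x)"
    using s t tendsto_pre_ip_represents[OF assms(1)]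
    by (intro the_equality) (blast intro: LIMSEQ_unique)+
  then show ?thesis
    by (simp add: rkhs_def)
qed

lemma lin_span_subset_rkhs: "lin_span K (kfun k) \<subseteq> vecs (rkhs K k)"
  using represents_const by (auto simp: rkhs_def)

lemma hnorm_rkhs_zero:
  assumes "0 \<in> K"
  shows "hnorm (rkhs K k) (\<lambda>z. 0) = 0"
proof -
  have zero: "(\<lambda>z. 0) = lin_comb (kfun k) {} (\<lambda>_. 0)"
    by (simp add: lin_comb_def)
  then have "(\<lambda>z. 0) \<in> lin_span K (kfun k)"
    unfolding lin_span_def using assms by blast
  then have "(\<lambda>z. 0) \<in> vecs (rkhs K k)"
    using lin_span_subset_rkhs by blast
  then have "ip (rkhs K k) (\<lambda>z. 0) (\<lambda>z. 0) = 0"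
    using rkhs_reproducing[of "{}" "\<lambda>_. 0" K "\<lambda>z. 0"] assms by (simp add: lin_comb_def)
  then show ?thesis
    by (simp add: hnorm_def)
qed

end


subsection \<open>The operator \<open>B\<close>\<close>

lemma delta_in_l2_space:
  assumes "0 \<in> K" "1 \<in> K"
  shows "delta x \<in> vecs (l2_space K)"
proof -
  have "(\<lambda>z. (cmod (delta x z))\<^sup>2) summable_on UNIV \<longleftrightarrow> (\<lambda>z. (cmod (delta x z))\<^sup>2) summable_on {x}"
    by (rule summable_on_cong_neutral) (auto simp: delta_def)
  then show ?thesis
    using assms by (simp add: l2_space_def delta_def)
qed

lemma ip_l2_space_delta: "ip (l2_space K) f (delta x) = cnj (f x)"
proof -
  have "(\<Sum>\<^sub>\<infinity>z. cnj (f z) * delta x z) = (\<Sum>\<^sub>\<infinity>z\<in>{x}. cnj (f z) * delta x z)"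
    by (rule infsum_cong_neutral) (auto simp: delta_def)
  then show ?thesis
    by (simp add: l2_space_def delta_def)
qed

text \<open>On each element of the graph both inner products pick out the conjugate of the
  coefficient at \<open>x\<close>: in l2 by orthonormality, in the kernel space by the reproducing
  property.\<close>

lemma delta_in_op_adjoint:
  assumes "pd_kernel k" "0 \<in> K" "1 \<in> K" "delta x \<in> vecs (rkhs K k)"
  shows "(delta x, delta x) \<in> op_adjoint (rkhs K k) (l2_space K) (lin_op K (kfun k) delta)"
proof -
  have "ip (l2_space K) (lin_comb delta F c) (delta x)
      = ip (rkhs K k) (lin_comb (kfun k) F c) (delta x)"
    if "finite F" "\<forall>y. c y \<in> K" for F c
  proof -
    have "ip (rkhs K k) (lin_comb (kfun k) F c) (delta x) = (\<Sum>y\<in>F. cnj (c y) * delta x y)"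
      using assms(1) that assms(4) by (rule rkhs_reproducing)
    also have "\<dots> = (if x \<in> F then cnj (c x) else 0)"
      using that(1) by (simp add: delta_def if_distrib cong: if_cong)
    finally show ?thesis
      using that(1) by (simp add: ip_l2_space_delta lin_comb_delta)
  qed
  then show ?thesis
    using assms by (auto simp: op_adjoint_def lin_op_def delta_in_l2_space)
qed

text \<open>Constant sequences converge. A \<open>fun_space\<close> is an arbitrary record, so the
  vanishing norm of the zero function enters as an assumption.\<close>

lemma op_closure_superset:
  assumes "(f, g) \<in> T" "f \<in> vecs S" "g \<in> vecs S'"
    and "hnorm S (\<lambda>z. 0) = 0" "hnorm S' (\<lambda>z. 0) = 0"
  shows "(f, g) \<in> op_closure S S' T"
proof -
  have "\<exists>u v. (\<forall>n::nat. (u n, v n) \<in> T) \<and>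
      (\<lambda>n. hnorm S (\<lambda>z. u n z - f z)) \<longlonglongrightarrow> 0 \<and> (\<lambda>n. hnorm S' (\<lambda>z. v n z - g z)) \<longlonglongrightarrow> 0"
    by (rule exI[of _ "\<lambda>_. f"], rule exI[of _ "\<lambda>_. g"]) (simp add: assms)
  then show ?thesis
    by (simp add: op_closure_def assms)
qed

lemma kfun_in_op_closure:
  assumes "pd_kernel k" "0 \<in> K" "1 \<in> K"
  shows "(kfun k x, delta x) \<in> op_closure (rkhs K k) (l2_space K) (lin_op K (kfun k) delta)"
proof (rule op_closure_superset)
  have single: "kfun k x = lin_comb (kfun k) {x} (\<lambda>_. 1)" "delta x = lin_comb delta {x} (\<lambda>_. 1)"
    by (simp_all add: lin_comb_single)
  then show "(kfun k x, delta x) \<in> lin_op K (kfun k) delta"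
    unfolding lin_op_def using assms by blast
  have "kfun k x \<in> lin_span K (kfun k)"
    unfolding lin_span_def using single assms by blast
  then show "kfun k x \<in> vecs (rkhs K k)"
    using lin_span_subset_rkhs[OF assms(1)] by blast
  show "hnorm (l2_space K) (\<lambda>z. 0) = 0"
    by (simp add: hnorm_def l2_space_def)
qed (use assms in \<open>simp_all add: delta_in_l2_space hnorm_rkhs_zero\<close>)

theorem theorem4p8:
  fixes k :: "'v \<Rightarrow> 'v \<Rightarrow> complex"
    and K :: "complex set"
    and A B :: "'v operator"
  assumes "infinite (UNIV :: 'v set)" and "countable (UNIV :: 'v set)"
    and "K = UNIV \<or> K = \<real>"
    and "\<forall>x y. k x y \<in> K"
    and "pd_kernel k"
    and "\<forall>x. delta x \<in> vecs (rkhs K k)"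
    and "(A, B) = canonical_pair K k"
  shows "\<forall>x. kfun k x \<in> Domain (op_closure (rkhs K k) (l2_space K) B
                                   O op_adjoint (rkhs K k) (l2_space K) B)"
proof
  fix x
  have K: "0 \<in> K" "1 \<in> K"
    using assms(3) by auto
  have B: "B = lin_op K (kfun k) delta"
    using assms(7) by (simp add: canonical_pair_def)
  have "(kfun k x, delta x) \<in> op_closure (rkhs K k) (l2_space K) B"
    unfolding B using assms(5) K by (rule kfun_in_op_closure)
  \<comment> \<open>The same function occurs in two roles: as the argument it is a vector of l2, as
    the value a vector of the kernel space.\<close>
  moreover have "(delta x, delta x) \<in> op_adjoint (rkhs K k) (l2_space K) B"
    unfolding B using assms(5) K assms(6)[rule_format] by (rule delta_in_op_adjoint)
  ultimately show "kfun k x \<in> Domain (op_closure (rkhs K k) (l2_space K) B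
                                   O op_adjoint (rkhs K k) (l2_space K) B)"
    by blast
qed

end
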